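(* Let $k>1$ be real and let $a\in(0,1)$ satisfy $a>a_+^*(k)$, where $$a_+^*(k)=\frac{1}{2\left(k-\sqrt{k(k-1)}\right)}.$$ For $d>0$ consider the system $$\dot u_i=d\big(ku_{i+1}-(k+1)u_i+u_{i-1}\big)+g_{\mathrm{MK}}(u_i;a),\qquad i\in\mathbb Z,\ t>0,$$ where $g_{\mathrm{MK}}(u;a)=-u$ for $u<a$ and $g_{\mathrm{MK}}(u;a)=1-u$ for $u\ge a$. Then there exist values $0<\underline d_+(a,k)<\overline d_+(a,k)<\underline d_-(a,k)$ such that: (a) there is a stationary wave for $0<d\le\underline d_+(a,k)$; (b) there is a traveling wave with $c>0$ for $\underline d_+(a,k)<d<\overline d_+(a,k)$; (c) there is a stationary wave for $\overline d_+(a,k)\le d<\underline d_-(a,k)$; (d) there is a traveling wave with $c<0$ for $d>\underline d_-(a,k)$.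
   Context: A stationary wave is a time-independent solution $(u_i)_{i\in\mathbb Z}$ of the system that is increasing in $i$ and satisfies $u_i\to0$ as $i\to-\infty$ and $u_i\to1$ as $i\to+\infty$. A traveling wave with speed $c\ne0$ is a solution of the form $u_i(t)=U(i-ct)$ with a profile $U$ satisfying $U(-\infty)=0$ and $U(+\infty)=1$. *)

theory Defs
  imports "HOL-Analysis.Analysis"
begin

definition g_MK :: "real \<Rightarrow> real \<Rightarrow> real" where
  "g_MK a u = (if u < a then - u else 1 - u)"

definition lattice_rhs :: "real \<Rightarrow> real \<Rightarrow> real \<Rightarrow> (int \<Rightarrow> real \<Rightarrow> real) \<Rightarrow> int \<Rightarrow> real \<Rightarrow> real" where
  "lattice_rhs d k a u i t =
     d * (k * u (i + 1) t - (k + 1) * u i t + u (i - 1) t) + g_MK a (u i t)"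

(* Since g_MK jumps at u = a, a component passing through the value a has a kink there, so no
   moving front can satisfy the differential equation at every single time. Solutions are
   therefore taken in the Caratheodory sense, that is, the equation is required in integrated
   form. This forces every u i to be continuous, hence the integrand to be locally bounded and
   measurable, so the gauge integral is a Lebesgue integral, every u i is locally absolutely
   continuous, and the differential equation holds for almost every t > 0, in particular in the
   classical sense at every t > 0 with u i t \<noteq> a. *)
definition lattice_solution :: "real \<Rightarrow> real \<Rightarrow> real \<Rightarrow> (int \<Rightarrow> real \<Rightarrow> real) \<Rightarrow> bool" where
  "lattice_solution d k a u \<longleftrightarrow>
     (\<forall>i s t. 0 < s \<and> s \<le> t \<longrightarrow> (lattice_rhs d k a u i has_integral (u i t - u i s)) {s..t})"

definition stationary_wave :: "real \<Rightarrow> real \<Rightarrow> real \<Rightarrow> (int \<Rightarrow> real) \<Rightarrow> bool" where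
  "stationary_wave d k a v \<longleftrightarrow>
     lattice_solution d k a (\<lambda>i t. v i) \<and> strict_mono v \<and>
     (v \<longlongrightarrow> 0) at_bot \<and> (v \<longlongrightarrow> 1) at_top"

definition traveling_wave :: "real \<Rightarrow> real \<Rightarrow> real \<Rightarrow> real \<Rightarrow> (real \<Rightarrow> real) \<Rightarrow> bool" where
  "traveling_wave d k a c U \<longleftrightarrow>
     c \<noteq> 0 \<and> lattice_solution d k a (\<lambda>i t. U (real_of_int i - c * t)) \<and>
     (U \<longlongrightarrow> 0) at_bot \<and> (U \<longlongrightarrow> 1) at_top"

definition a_plus_star :: "real \<Rightarrow> real" where
  "a_plus_star k = 1 / (2 * (k - sqrt (k * (k - 1))))"

end

theory Submission
  imports Defs
begin

text \<open>
  Replace \<open>g_MK\<close> along a front crossing the value \<open>a\<close> exactly at the origin by \<open>- U + H\<close> with the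
  Heaviside function \<open>H\<close>. The resulting equation is linear, and its bounded solution is
  \<open>U\<^sub>c(x) = P(x + c T + N\<^sub>T \<ge> 0)\<close>, where \<open>N\<close> is the walk on the integers that jumps up at rate
  \<open>d k\<close> and down at rate \<open>d\<close>, and \<open>T\<close> is an independent exponential time. So a wave of speed
  \<open>c \<noteq> 0\<close> exists as soon as \<open>U\<^sub>c(0) = a\<close>. The function \<open>c \<mapsto> U\<^sub>c(0)\<close> is continuous off \<open>c = 0\<close>, tends to
  \<open>0\<close> and \<open>1\<close> at the two infinities, and jumps at \<open>c = 0\<close> from \<open>U\<^sub>0(-1)\<close> to \<open>U\<^sub>0(0)\<close>; the sequence
  \<open>U\<^sub>0(n)\<close> is itself a stationary wave exactly when \<open>a\<close> lies in this half-open gap.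

  The two ends of the gap are explicit in the root \<open>x\<close> in \<open>(0, 1/k)\<close> of
  \<open>d (1 - x) (1 - k x) = x\<close>, which increases with \<open>d\<close>: the upper end is \<open>(1 - x) / (1 - k x\<^sup>2)\<close>, which
  decreases to the minimum \<open>a\<^sub>+\<^sup>*(k)\<close> and then increases to \<open>1\<close>, and the lower end is \<open>k x\<close> times that,
  which increases from \<open>0\<close> to \<open>1\<close>. For \<open>a > a\<^sub>+\<^sup>*(k)\<close> the level \<open>a\<close> is therefore crossed twice by the
  upper end and once by the lower end.
\<close>

section \<open>The exponential clock and an auxiliary limit\<close>

lemma exp_minus_integrable: "integrable lborel (\<lambda>s::real. indicator {a..} s * exp (- s))"
proof -
  have "(\<lambda>s::real. exp (- s)) absolutely_integrable_on {a..}"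
    using integrable_on_exp_minus_to_infinity[of 1 a]
    by (intro nonnegative_absolutely_integrable_1) auto
  then have "integrable lebesgue (\<lambda>s::real. indicator {a..} s * exp (- s))"
    by (simp add: set_integrable_def)
  then show ?thesis
    by (subst integrable_completion[symmetric]) auto
qed

lemma exp_minus_integral: "(LINT s|lborel. indicator {0..} s * exp (- s)) = (1::real)"
proof -
  have "((\<lambda>s::real. indicator {0..} s * exp (- s)) has_integral
      (LINT s|lborel. indicator {0..} s * exp (- s))) UNIV"
    by (rule has_integral_integral_lborel) (rule exp_minus_integrable)
  moreover have "((\<lambda>s::real. exp (- s)) has_integral 1) {0..}"
    using has_integral_exp_minus_to_infinity[of 1 0] by simp
  then have "((\<lambda>s::real. indicator {0..} s * exp (- s)) has_integral 1) UNIV"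
    by (subst (asm) has_integral_restrict_UNIV[symmetric])
      (simp add: indicator_def of_bool_def mult_if_delta if_distrib[of "\<lambda>c. c * _"] cong: if_cong)
  ultimately show ?thesis by (rule has_integral_unique)
qed

lemma filterlim_floor_at_bot: "filterlim (floor :: real \<Rightarrow> int) at_bot at_bot"
  unfolding filterlim_at_bot
proof
  fix Z :: int
  show "eventually (\<lambda>x::real. \<lfloor>x\<rfloor> \<le> Z) at_bot"
    by (rule eventually_mono[OF eventually_le_at_bot[of "real_of_int Z"]]) linarith
qed

definition pinning_upper :: "real \<Rightarrow> real \<Rightarrow> real" where
  "pinning_upper k x = (1 - x) / (1 - k * x\<^sup>2)"

definition pinning_lower :: "real \<Rightarrow> real \<Rightarrow> real" where
  "pinning_lower k x = k * x * pinning_upper k x"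

section \<open>The killed biased walk\<close>

locale biased_walk =
  fixes d k :: real
  assumes d_pos: "d > 0" and k_pos: "k > 0"
begin

definition total_rate :: real where
  "total_rate = d * (k + 1)"

primrec path_weight :: "nat \<Rightarrow> int \<Rightarrow> real" where
  "path_weight 0 = (\<lambda>n. if n \<ge> 0 then 1 else 0)"
| "path_weight (Suc j) = (\<lambda>n. d * (k * path_weight j (n + 1) + path_weight j (n - 1)))"

text \<open>The coefficient \<open>path_weight j n\<close> is the weight of all \<open>j\<close>-step paths from \<open>n\<close> that end
  in the nonnegative integers. Hence \<open>kernel s n\<close> is the probability that an exponential clock of
  rate 1 has not rung by time \<open>s\<close> and that the walk started at \<open>n\<close> is nonnegative then.\<close>

definition weight_series :: "real \<Rightarrow> int \<Rightarrow> real" where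
  "weight_series s n = (\<Sum>j. path_weight j n / fact j * s ^ j)"

definition kernel :: "real \<Rightarrow> int \<Rightarrow> real" where
  "kernel s n = exp (- (total_rate + 1) * s) * weight_series s n"

text \<open>The density \<open>exp (- s)\<close> of the clock is already contained in
  \<open>kernel\<close>. The walk is integer-valued, so \<open>x + c * s\<close> plus the walk is
  nonnegative exactly when its floor plus the walk is; this is why only the floor enters.\<close>

definition front :: "real \<Rightarrow> real \<Rightarrow> real" where
  "front c x = (LINT s|lborel. indicator {0..} s * kernel s \<lfloor>x + c * s\<rfloor>)"

lemma total_rate_pos: "total_rate > 0"
  using d_pos k_pos by (simp add: total_rate_def)

lemma path_weight_nonneg: "0 \<le> path_weight j n"
  using d_pos k_pos by (induction j arbitrary: n) auto

lemma path_weight_le: "path_weight j n \<le> total_rate ^ j"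
proof (induction j arbitrary: n)
  case (Suc j)
  have "d * (k * path_weight j (n + 1) + path_weight j (n - 1))
      \<le> d * (k * total_rate ^ j + total_rate ^ j)"
    using Suc d_pos k_pos by (intro mult_left_mono add_mono) auto
  then show ?case by (simp add: total_rate_def algebra_simps)
qed auto

lemma path_weight_step: "path_weight j n \<le> path_weight j (n + 1)"
proof (induction j arbitrary: n)
  case (Suc j)
  show ?case
    using d_pos k_pos Suc[of "n + 1"] Suc[of "n - 1"]
    by (auto intro!: mult_left_mono add_mono simp: algebra_simps)
qed auto

lemma path_weight_eq_0: "n < - int j \<Longrightarrow> path_weight j n = 0"
  by (induction j arbitrary: n) auto

lemma path_weight_eq_power: "n \<ge> int j \<Longrightarrow> path_weight j n = total_rate ^ j"
  by (induction j arbitrary: n) (auto simp: total_rate_def algebra_simps)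

lemma summable_exp_coeff: "summable (\<lambda>j. (total_rate ^ j / fact j) * (s::real) ^ j)"
  using summable_exp[of "total_rate * s"] by (simp add: field_simps power_mult_distrib)

lemma suminf_exp_coeff: "(\<Sum>j. (total_rate ^ j / fact j) * s ^ j) = exp (total_rate * s)"
  by (simp add: exp_def divide_inverse mult_ac power_mult_distrib)

lemma summable_weight: "summable (\<lambda>j. path_weight j n / fact j * s ^ j)"
proof (rule summable_comparison_test)
  show "summable (\<lambda>j. (total_rate ^ j / fact j) * \<bar>s\<bar> ^ j)"
    by (rule summable_exp_coeff)
  show "\<exists>N. \<forall>j\<ge>N. norm (path_weight j n / fact j * s ^ j) \<le> (total_rate ^ j / fact j) * \<bar>s\<bar> ^ j"
    using path_weight_nonneg path_weight_le total_rate_pos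
    by (auto simp: abs_mult power_abs intro!: mult_right_mono divide_right_mono)
qed

text \<open>Termwise differentiation shifts the coefficients by one index, and the recursion of
  \<open>path_weight\<close> on its first step turns this shift into the two neighbours: a backward
  Kolmogorov equation.\<close>

lemma weight_series_has_derivative:
  "((\<lambda>s. weight_series s n) has_real_derivative
     d * (k * weight_series s (n + 1) + weight_series s (n - 1))) (at s)"
proof -
  have "diffs (\<lambda>j. path_weight j n / fact j) j =
      d * k * (path_weight j (n + 1) / fact j) + d * (path_weight j (n - 1) / fact j)" for j
    by (simp add: diffs_def add_divide_distrib algebra_simps del: of_nat_Suc)
  then have "(\<Sum>j. diffs (\<lambda>j. path_weight j n / fact j) j * s ^ j) =
      (\<Sum>j. d * k * (path_weight j (n + 1) / fact j * s ^ j)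
           + d * (path_weight j (n - 1) / fact j * s ^ j))"
    by (simp add: algebra_simps)
  also have "\<dots> = d * k * weight_series s (n + 1) + d * weight_series s (n - 1)"
    unfolding weight_series_def
    by (intro sums_unique[symmetric] sums_add sums_mult summable_sums summable_weight)
  also have "\<dots> = d * (k * weight_series s (n + 1) + weight_series s (n - 1))"
    by (simp add: algebra_simps)
  finally show ?thesis
    using termdiffs_strong_converges_everywhere[of "\<lambda>j. path_weight j n / fact j" s,
        OF summable_weight]
    unfolding weight_series_def[abs_def] by simp
qed

text \<open>The exponential prefactor contributes \<open>- (total_rate + 1)\<close>:
  \<open>total_rate\<close> is the diagonal of the lattice operator and the remaining
  \<open>1\<close> is the killing rate, which becomes the reaction term \<open>- u\<close>.\<close>

lemma kernel_has_derivative: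
  "((\<lambda>s. kernel s n) has_real_derivative
     d * (k * kernel s (n + 1) - (k + 1) * kernel s n + kernel s (n - 1)) - kernel s n) (at s)"
  unfolding kernel_def
  by (auto intro!: derivative_eq_intros weight_series_has_derivative
      simp: total_rate_def algebra_simps)

lemma kernel_0: "kernel 0 n = (if n \<ge> 0 then 1 else 0)"
  by (simp add: kernel_def weight_series_def powser_zero del: times_divide_eq_left)

lemma continuous_kernel: "continuous_on A (\<lambda>s. kernel s n)"
  using kernel_has_derivative DERIV_isCont continuous_at_imp_continuous_on by blast

lemma measurable_kernel [measurable]: "(\<lambda>s. kernel s n) \<in> borel_measurable borel"
  by (intro borel_measurable_continuous_onI continuous_kernel)

lemma kernel_nonneg: "s \<ge> 0 \<Longrightarrow> 0 \<le> kernel s n"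
  unfolding kernel_def weight_series_def
  by (intro mult_nonneg_nonneg suminf_nonneg summable_weight divide_nonneg_nonneg path_weight_nonneg)
    auto

lemma kernel_le:
  assumes "s \<ge> 0"
  shows "kernel s n \<le> exp (- s)"
proof -
  have "weight_series s n \<le> exp (total_rate * s)"
    unfolding weight_series_def suminf_exp_coeff[symmetric] using assms
    by (intro suminf_le summable_weight summable_exp_coeff mult_right_mono divide_right_mono
        path_weight_le) auto
  then have "kernel s n \<le> exp (- (total_rate + 1) * s) * exp (total_rate * s)"
    by (simp add: kernel_def)
  then show ?thesis
    by (simp add: exp_add[symmetric] algebra_simps)
qed

lemma kernel_mono:
  assumes "s \<ge> 0" "m \<le> n"
  shows "kernel s m \<le> kernel s n"
proof -
  have "path_weight j m \<le> path_weight j n" for j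
    using assms(2) by (induction n rule: int_ge_induct) (auto intro: order_trans path_weight_step)
  then show ?thesis
    unfolding kernel_def weight_series_def using assms(1)
    by (intro mult_left_mono suminf_le summable_weight mult_right_mono divide_right_mono) auto
qed

text \<open>At the levels 1 and -1 the one-step paths alone separate \<open>n\<close> from
  \<open>n - 1\<close>: their weights differ by \<open>d\<close> and by \<open>d * k\<close>
  respectively. These are the levels at which strict monotonicity of fronts is read off.\<close>

lemma kernel_strict:
  assumes "s > 0" "\<bar>n\<bar> = 1"
  shows "kernel s (n - 1) < kernel s n"
proof -
  have "0 < (\<Sum>j. (path_weight j n / fact j * s ^ j) - (path_weight j (n - 1) / fact j * s ^ j))"
  proof (rule suminf_pos2[where i = 1])
    show "summable (\<lambda>j. (path_weight j n / fact j * s ^ j) - (path_weight j (n - 1) / fact j * s ^ j))"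
      by (intro summable_diff summable_weight)
    show "0 \<le> (path_weight j n / fact j * s ^ j) - (path_weight j (n - 1) / fact j * s ^ j)" for j
      using path_weight_step[of j "n - 1"] assms
      by (auto intro!: mult_right_mono divide_right_mono)
    have "n = 1 \<or> n = - 1" using assms by auto
    then show "0 < (path_weight 1 n / fact 1 * s ^ 1) - (path_weight 1 (n - 1) / fact 1 * s ^ 1)"
      using assms d_pos k_pos by (auto simp: algebra_simps)
  qed
  then have "0 < weight_series s n - weight_series s (n - 1)"
    unfolding weight_series_def by (simp add: suminf_diff summable_weight del: times_divide_eq_left)
  then show ?thesis by (simp add: kernel_def)
qed

text \<open>Each coefficient is eventually constant in \<open>n\<close> and is dominated by the
  exponential series, so Tannery's theorem exchanges limit and sum.\<close>

lemma kernel_at_top: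
  assumes "s \<ge> 0"
  shows "((\<lambda>n. kernel s n) \<longlongrightarrow> exp (- s)) at_top"
proof -
  have "((\<lambda>n. weight_series s n) \<longlongrightarrow> (\<Sum>j. (total_rate ^ j / fact j) * s ^ j)) at_top"
    unfolding weight_series_def
  proof (rule tannerys_theorem[THEN conjunct2, THEN conjunct2])
    show "((\<lambda>n. path_weight j n / fact j * s ^ j) \<longlongrightarrow> total_rate ^ j / fact j * s ^ j) at_top" for j
      by (rule tendsto_eventually, rule eventually_mono[OF eventually_ge_at_top[of "int j"]])
        (simp add: path_weight_eq_power)
    show "\<forall>\<^sub>F (j, n) in at_top \<times>\<^sub>F at_top.
        norm (path_weight j n / fact j * s ^ j) \<le> (total_rate ^ j / fact j) * s ^ j"
      using assms path_weight_nonneg path_weight_le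
      by (intro always_eventually)
        (auto simp: abs_mult intro!: mult_right_mono divide_right_mono)
  qed (auto simp: summable_exp_coeff simp del: times_divide_eq_left)
  then have "((\<lambda>n. kernel s n) \<longlongrightarrow> exp (- (total_rate + 1) * s) * exp (total_rate * s)) at_top"
    unfolding kernel_def suminf_exp_coeff by (intro tendsto_intros)
  then show ?thesis
    by (simp add: exp_add[symmetric] algebra_simps)
qed

lemma kernel_at_bot:
  assumes "s \<ge> 0"
  shows "((\<lambda>n. kernel s n) \<longlongrightarrow> 0) at_bot"
proof -
  have "((\<lambda>n. weight_series s n) \<longlongrightarrow> (\<Sum>j. 0)) at_bot"
    unfolding weight_series_def
  proof (rule tannerys_theorem[THEN conjunct2, THEN conjunct2])
    show "((\<lambda>n. path_weight j n / fact j * s ^ j) \<longlongrightarrow> 0) at_bot" for j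
      by (rule tendsto_eventually, rule eventually_mono[OF eventually_le_at_bot[of "- int j - 1"]])
        (simp add: path_weight_eq_0)
    show "\<forall>\<^sub>F (j, n) in at_top \<times>\<^sub>F at_bot.
        norm (path_weight j n / fact j * s ^ j) \<le> (total_rate ^ j / fact j) * s ^ j"
      using assms path_weight_nonneg path_weight_le
      by (intro always_eventually)
        (auto simp: abs_mult intro!: mult_right_mono divide_right_mono)
  qed (auto simp: summable_exp_coeff simp del: times_divide_eq_left)
  from tendsto_mult[OF tendsto_const this, of "exp (- (total_rate + 1) * s)"] show ?thesis
    by (simp add: kernel_def)
qed

section \<open>Fronts\<close>

lemma front_integrand_measurable [measurable]:
  "(\<lambda>s. indicator {0..} s * kernel s \<lfloor>x + c * s\<rfloor>) \<in> borel_measurable borel"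
proof -
  have "(\<lambda>s. kernel s \<lfloor>x + c * s\<rfloor>) \<in> borel_measurable borel"
    by (rule measurable_compose_countable[where g = "\<lambda>s. \<lfloor>x + c * s\<rfloor>"]) measurable
  then show ?thesis by measurable
qed

lemma front_integrand_bound:
  "norm (indicator {0..} s * kernel s n) \<le> indicator {0..} s * exp (- s)"
  using kernel_nonneg kernel_le by (auto simp: indicator_def)

lemma front_integrand_integrable:
  "integrable lborel (\<lambda>s. indicator {0..} s * kernel s \<lfloor>x + c * s\<rfloor>)"
proof (rule Bochner_Integration.integrable_bound[OF exp_minus_integrable])
  show "AE s in lborel. norm (indicator {0..} s * kernel s \<lfloor>x + c * s\<rfloor>)
      \<le> norm (indicator {0..} s * exp (- s) :: real)"
    using front_integrand_bound by (auto intro!: AE_I2 order_trans[OF front_integrand_bound])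
qed measurable

lemma front_nonneg: "0 \<le> front c x"
  unfolding front_def by (intro integral_nonneg_AE AE_I2) (auto simp: indicator_def kernel_nonneg)

lemma front_le_1: "front c x \<le> 1"
  unfolding front_def exp_minus_integral[symmetric]
  by (intro integral_mono front_integrand_integrable exp_minus_integrable)
    (auto simp: indicator_def kernel_le)

lemma front_mono: "x \<le> y \<Longrightarrow> front c x \<le> front c y"
  unfolding front_def
  by (intro integral_mono front_integrand_integrable)
    (auto simp: indicator_def intro!: kernel_mono floor_mono)

text \<open>Dominated convergence with majorant \<open>exp (- s)\<close>. Position and speed vary
  together, so that one statement covers the limits at infinity, continuity in \<open>c\<close> and
  the one-sided limits at \<open>c = 0\<close>. The countable set \<open>N\<close> absorbs the times
  at which the floor jumps.\<close>

lemma front_limit: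
  assumes "\<And>s. s > 0 \<Longrightarrow> s \<notin> N \<Longrightarrow>
    ((\<lambda>m. kernel s \<lfloor>x m + c m * s\<rfloor>) \<longlonglongrightarrow> g s)"
    and "countable N" and g: "(\<lambda>s. indicator {0..} s * g s) \<in> borel_measurable borel"
  shows "(\<lambda>m. front (c m) (x m)) \<longlonglongrightarrow> (LINT s|lborel. indicator {0..} s * g s)"
  unfolding front_def
proof (rule integral_dominated_convergence[where w = "\<lambda>s. indicator {0..} s * exp (- s)"])
  have "N \<union> {0} \<in> null_sets lborel"
    using assms(2) by (intro countable_imp_null_set_lborel) auto
  then have "AE s in lborel. s \<notin> N \<union> {0}" by (rule AE_not_in)
  then show "AE s in lborel. (\<lambda>m. indicator {0..} s * kernel s \<lfloor>x m + c m * s\<rfloor>)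
      \<longlonglongrightarrow> indicator {0..} s * g s"
  proof eventually_elim
    case (elim s)
    then show ?case
      by (cases "s > 0") (auto simp: indicator_def intro!: assms(1))
  qed
  show "(\<lambda>s. indicator {0..} s * g s) \<in> borel_measurable lborel"
    using g by simp
  show "AE s in lborel. norm (indicator {0..} s * kernel s \<lfloor>x m + c m * s\<rfloor>)
      \<le> indicator {0..} s * exp (- s)" for m
    by (intro AE_I2 front_integrand_bound)
qed (auto intro: exp_minus_integrable)

text \<open>The integrands differ while \<open>c s\<close> is just above the integer \<open>sgn c\<close>: there the two floors are
  separated by a level at which the kernel is strictly increasing.\<close>

lemma front_strict:
  assumes "c \<noteq> 0" "x < 0"
  shows "front c x < front c 0"
proof -
  define n :: int where "n = (if c > 0 then 1 else - 1)"
  \<comment> \<open>At time \<open>a\<close> the point \<open>c * s\<close> passes through the level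
    \<open>n\<close>, at time \<open>b\<close> the point \<open>x + c * s\<close> does;
    \<open>max 0\<close> covers the case that the latter starts below -1. Which time comes first
    depends on the sign of \<open>c\<close>, hence \<open>l\<close> and \<open>u\<close>.\<close>
  define a b where "a = 1 / \<bar>c\<bar>" and "b = (if c > 0 then (1 - x) / c else max 0 (1 + x) / \<bar>c\<bar>)"
  define l u where "l = min a b" and "u = max a b"
  have lu: "0 \<le> l" "l < u"
    using assms by (auto simp: l_def u_def a_def b_def divide_simps max_def min_def)
  have less: "kernel s \<lfloor>x + c * s\<rfloor> < kernel s \<lfloor>0 + c * s\<rfloor>" if s: "s \<in> {l<..<u}" for s
  proof -
    have "s > 0" using s lu by auto
    have 1: "n \<le> \<lfloor>0 + c * s\<rfloor> \<and> \<lfloor>x + c * s\<rfloor> \<le> n - 1"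
    proof (cases "c > 0")
      case True
      then have "1 / c < (1 - x) / c" using assms by (simp add: divide_strict_right_mono)
      then have "1 < c * s" "c * s < 1 - x"
        using s True by (auto simp: l_def u_def a_def b_def field_simps)
      then show ?thesis using True by (auto simp: n_def le_floor_iff floor_le_iff)
    next
      case False
      then have "c < 0" using assms by simp
      have "b < a" using assms \<open>c < 0\<close> by (auto simp: a_def b_def divide_simps)
      then have "b < s" "s < a" using s by (auto simp: l_def u_def)
      then have "- c * s < 1" "1 + x < - c * s"
        using \<open>c < 0\<close> by (auto simp: a_def b_def field_simps)
      then show ?thesis using False by (auto simp: n_def le_floor_iff floor_le_iff)
    qed
    have "kernel s \<lfloor>x + c * s\<rfloor> \<le> kernel s (n - 1)" using 1 \<open>s > 0\<close> by (intro kernel_mono) auto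
    also have "\<dots> < kernel s n" by (rule kernel_strict) (use \<open>s > 0\<close> in \<open>auto simp: n_def\<close>)
    also have "\<dots> \<le> kernel s \<lfloor>0 + c * s\<rfloor>" using 1 \<open>s > 0\<close> by (intro kernel_mono) auto
    finally show ?thesis .
  qed
  \<comment> \<open>Equality would make the nonnegative difference of the integrands vanish almost
    everywhere, although it is positive on an interval of positive length.\<close>
  have "front c x \<noteq> front c 0"
  proof
    assume eq: "front c x = front c 0"
    let ?f = "\<lambda>x s. indicator {0..} s * kernel s \<lfloor>x + c * s\<rfloor>"
    have "(LINT s|lborel. ?f 0 s - ?f x s) = 0"
      using eq by (subst Bochner_Integration.integral_diff)
        (use front_integrand_integrable[of 0 c] in
          \<open>auto intro: front_integrand_integrable simp: front_def\<close>)
    moreover have "integrable lborel (\<lambda>s. ?f 0 s - ?f x s)"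
      by (intro Bochner_Integration.integrable_diff front_integrand_integrable)
    moreover have "AE s in lborel. 0 \<le> ?f 0 s - ?f x s"
      using assms by (intro AE_I2) (auto simp: indicator_def intro!: kernel_mono floor_mono)
    ultimately have "AE s in lborel. ?f 0 s - ?f x s = 0"
      by (subst (asm) integral_nonneg_eq_0_iff_AE) auto
    then have "AE s in lborel. s \<notin> {l<..<u}"
    proof eventually_elim
      case (elim s)
      then show ?case using less[of s] lu by (auto simp: indicator_def)
    qed
    then have "{l<..<u} \<in> null_sets lborel"
      by (subst (asm) AE_iff_null_sets[symmetric]) auto
    then show False using lu by (auto simp: null_sets_def)
  qed
  with front_mono[of x 0 c] assms show ?thesis by auto
qed

lemma front_at_top:
  assumes "\<And>s. s > 0 \<Longrightarrow> filterlim (\<lambda>m. x m + c m * s) at_top sequentially"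
  shows "(\<lambda>m. front (c m) (x m)) \<longlonglongrightarrow> 1"
proof -
  have "(\<lambda>m. front (c m) (x m)) \<longlonglongrightarrow> (LINT s|lborel. indicator {0..} s * exp (- s))"
  proof (rule front_limit[where N = "{}"])
    show "(\<lambda>m. kernel s \<lfloor>x m + c m * s\<rfloor>) \<longlonglongrightarrow> exp (- s)" if "s > 0" for s
      by (rule filterlim_compose[OF kernel_at_top])
        (use that in \<open>auto intro!: filterlim_compose[OF filterlim_floor_sequentially] assms\<close>)
  qed auto
  then show ?thesis by (simp add: exp_minus_integral)
qed

lemma front_at_bot:
  assumes "\<And>s. s > 0 \<Longrightarrow> filterlim (\<lambda>m. x m + c m * s) at_bot sequentially"
  shows "(\<lambda>m. front (c m) (x m)) \<longlonglongrightarrow> 0"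
proof -
  have "(\<lambda>m. front (c m) (x m)) \<longlonglongrightarrow> (LINT s|lborel. indicator {0::real..} s * 0)"
  proof (rule front_limit[where N = "{}" and g = "\<lambda>_. 0"])
    show "(\<lambda>m. kernel s \<lfloor>x m + c m * s\<rfloor>) \<longlonglongrightarrow> 0" if "s > 0" for s
      by (rule filterlim_compose[OF kernel_at_bot])
        (use that in \<open>auto intro!: filterlim_compose[OF filterlim_floor_at_bot] assms\<close>)
  qed auto
  then show ?thesis by simp
qed

section \<open>The equation along a front and its limits at infinity\<close>

lemma front_shift:
  "front c (x - c * t) = (LINT r|lborel. indicator {0..} (t + r) * kernel (t + r) \<lfloor>x + c * r\<rfloor>)"
  "integrable lborel (\<lambda>r. indicator {0..} (t + r) * kernel (t + r) \<lfloor>x + c * r\<rfloor>)"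
proof -
  have eq: "x - c * t + c * (t + 1 * r) = x + c * r" for r by (simp add: algebra_simps)
  show "front c (x - c * t) = (LINT r|lborel. indicator {0..} (t + r) * kernel (t + r) \<lfloor>x + c * r\<rfloor>)"
    unfolding front_def
    by (subst lborel_integral_real_affine[where c = 1 and t = t]) (simp_all only: eq, simp_all)
  show "integrable lborel (\<lambda>r. indicator {0..} (t + r) * kernel (t + r) \<lfloor>x + c * r\<rfloor>)"
    using lborel_integrable_real_affine[OF front_integrand_integrable[of "x - c * t" c], of 1 t]
    by (simp only: eq) simp
qed

text \<open>After the shift \<open>s = t + r\<close> the floor no longer depends on \<open>t\<close>, so the kernel equation can be
  integrated in \<open>t\<close> first and Fubini gives the integrated equation. The step function is the boundary
  value \<open>kernel 0\<close>.\<close>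

lemma front_linear_equation:
  assumes t12: "t1 \<le> t2"
  shows "((\<lambda>t. d * (k * front c (x + 1 - c * t) - (k + 1) * front c (x - c * t) + front c (x - 1 - c * t))
              - front c (x - c * t) + (if x - c * t \<ge> 0 then 1 else 0))
          has_integral (front c (x - c * t2) - front c (x - c * t1))) {t1..t2}"
proof -
  define kd where
    "kd s n = d * (k * kernel s (n + 1) - (k + 1) * kernel s n + kernel s (n - 1)) - kernel s n" for s n
  define P where "P t r = indicator {0..} (t + r) * kernel (t + r) \<lfloor>x + c * r\<rfloor>" for t r :: real
  define Q where "Q t r = indicator {0..} (t + r) * kd (t + r) \<lfloor>x + c * r\<rfloor>" for t r :: real
  define g where "g t r = indicator {t1..t2} t * Q t r" for t r :: real
  define L where "L t = d * (k * front c (x + 1 - c * t) - (k + 1) * front c (x - c * t)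
      + front c (x - 1 - c * t)) - front c (x - c * t)" for t
  define H where "H y = (if y \<ge> 0 then 1 else 0 :: real)" for y :: real
  have [measurable]: "(\<lambda>s. kd s n) \<in> borel_measurable borel" for n
    unfolding kd_def by measurable
  have [measurable]: "H \<in> borel_measurable borel"
    unfolding H_def[abs_def] by measurable
  have [measurable]: "case_prod g \<in> borel_measurable (lborel \<Otimes>\<^sub>M lborel)"
  proof -
    have "(\<lambda>p. kd (fst p + snd p) \<lfloor>x + c * snd p\<rfloor>) \<in> borel_measurable (lborel \<Otimes>\<^sub>M lborel)"
      by (rule measurable_compose_countable[where g = "\<lambda>p. \<lfloor>x + c * snd p\<rfloor>"]) measurable
    then show ?thesis
      unfolding g_def Q_def case_prod_beta' by measurable
  qed

  have kd_bound: "\<bar>kd s n\<bar> \<le> (2 * total_rate + 1) * exp (- s)" if "s \<ge> 0" for s n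
  proof -
    note kb = kernel_nonneg[OF that] kernel_le[OF that]
    have "\<bar>k * kernel s (n + 1) - (k + 1) * kernel s n + kernel s (n - 1)\<bar>
        \<le> 2 * (k + 1) * exp (- s)"
    proof -
      have "k * kernel s (n + 1) \<le> k * exp (- s)" "0 \<le> k * kernel s (n + 1)"
        "(k + 1) * kernel s n \<le> (k + 1) * exp (- s)" "0 \<le> (k + 1) * kernel s n"
        using kb k_pos by (auto intro!: mult_left_mono)
      then show ?thesis using kb[of "n - 1"] by (simp add: abs_le_iff algebra_simps)
    qed
    then have "d * \<bar>k * kernel s (n + 1) - (k + 1) * kernel s n + kernel s (n - 1)\<bar>
        \<le> d * (2 * (k + 1) * exp (- s))"
      using d_pos by (intro mult_left_mono) auto
    then have "\<bar>d * (k * kernel s (n + 1) - (k + 1) * kernel s n + kernel s (n - 1))\<bar>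
        \<le> 2 * total_rate * exp (- s)"
      using d_pos by (simp add: abs_mult total_rate_def mult_ac)
    then show ?thesis using kb[of n] unfolding kd_def by (simp add: algebra_simps)
  qed

  have Q_eq: "Q t r = d * (k * (indicator {0..} (t + r) * kernel (t + r) \<lfloor>(x + 1) + c * r\<rfloor>)
      - (k + 1) * P t r + indicator {0..} (t + r) * kernel (t + r) \<lfloor>(x - 1) + c * r\<rfloor>) - P t r" for t r
  proof -
    have "\<lfloor>(x + 1) + c * r\<rfloor> = \<lfloor>x + c * r\<rfloor> + 1" "\<lfloor>(x - 1) + c * r\<rfloor> = \<lfloor>x + c * r\<rfloor> - 1"
      by linarith+
    then show ?thesis by (simp add: Q_def P_def kd_def algebra_simps)
  qed
  have P_int: "integrable lborel (P t)" for t
    unfolding P_def by (rule front_shift)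
  have P_integral: "(LINT r|lborel. P t r) = front c (x - c * t)" for t
    unfolding P_def by (rule front_shift(1)[symmetric])
  have Q_int: "integrable lborel (Q t)" and Q_integral: "(LINT r|lborel. Q t r) = L t" for t
    unfolding Q_eq[abs_def]
    using front_shift(2)[of t x c] front_shift(2)[of t "x + 1" c] front_shift(2)[of t "x - 1" c]
    by (simp_all add: L_def front_shift(1) P_def)

  \<comment> \<open>By \<open>kd_bound\<close> the integral of the modulus over \<open>r\<close> is
    at most \<open>2 * total_rate + 1\<close> uniformly in \<open>t\<close>, and \<open>t\<close>
    ranges over a bounded interval.\<close>
  have g_int: "integrable (lborel \<Otimes>\<^sub>M lborel) (case_prod g)"
  proof (rule lborel_pair.Fubini_integrable)
    have "(LINT r|lborel. norm (g t r)) \<le> indicator {t1..t2} t * (2 * total_rate + 1)" for t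
    proof -
      have *: "integrable lborel (\<lambda>r. indicator {0..} (t + r) * exp (- (t + r)))"
        "(LINT r|lborel. indicator {0..} (t + r) * exp (- (t + r))) = 1"
        using lborel_integrable_real_affine[OF exp_minus_integrable[of 0], of 1 t]
          lborel_integral_real_affine[of 1 "\<lambda>s. indicator {0..} s * exp (- s)" t] exp_minus_integral
        by auto
      have "(LINT r|lborel. norm (Q t r))
          \<le> (LINT r|lborel. (2 * total_rate + 1) * (indicator {0..} (t + r) * exp (- (t + r))))"
      proof (intro integral_mono integrable_norm integrable_mult_right Q_int *(1))
        fix r
        show "norm (Q t r) \<le> (2 * total_rate + 1) * (indicator {0..} (t + r) * exp (- (t + r)))"
          using kd_bound[of "t + r" "\<lfloor>x + c * r\<rfloor>"] by (auto simp: Q_def indicator_def)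
      qed
      also have "\<dots> = 2 * total_rate + 1" using *(2) by simp
      finally show ?thesis by (auto simp: g_def indicator_def)
    qed
    moreover have "0 \<le> (LINT r|lborel. norm (g t r))" for t
      by (intro Bochner_Integration.integral_nonneg) auto
    ultimately have "norm (LINT r|lborel. norm (g t r)) \<le> norm (indicator {t1..t2} t * (2 * total_rate + 1))" for t
      unfolding real_norm_def by (metis abs_ge_self abs_of_nonneg order_trans)
    moreover have "integrable lborel (\<lambda>t. indicator {t1..t2} t * (2 * total_rate + 1))"
      by (intro integrable_mult_left integrable_real_indicator) (auto simp: emeasure_lborel_Icc_eq)
    ultimately show "integrable lborel (\<lambda>t. LINT r|lborel. norm (case_prod g (t, r)))"
      by (elim Bochner_Integration.integrable_bound) (auto intro!: AE_I2)
    show "AE t in lborel. integrable lborel (\<lambda>r. case_prod g (t, r))"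
      using Q_int by (auto simp: g_def)
  qed simp

  \<comment> \<open>The cutoff \<open>t + r \<ge> 0\<close> makes the integration over
    \<open>t\<close> begin at \<open>- r\<close> when \<open>t1 < - r \<le> t2\<close>. The lower
    boundary value is then \<open>kernel 0\<close>, which is where the Heaviside term comes
    from.\<close>
  have inner: "(LINT t|lborel. g t r) = P t2 r - P t1 r - indicator {-t2..<-t1} r * H (x + c * r)" for r
  proof -
    define n where "n = \<lfloor>x + c * r\<rfloor>"
    have "n \<ge> 0 \<longleftrightarrow> x + c * r \<ge> 0" unfolding n_def by linarith
    then have H: "H (x + c * r) = kernel 0 n" by (simp add: H_def kernel_0)
    have FTC: "(LINT t|lborel. kd (t + r) n * indicator {u..t2} t) = kernel (t2 + r) n - kernel (u + r) n"
      if "u \<le> t2" for u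
    proof (rule integral_FTC_Icc_real[OF that])
      show "((\<lambda>t. kernel (t + r) n) has_real_derivative kd (t + r) n) (at t)" for t
        using DERIV_shift[THEN iffD1, OF kernel_has_derivative[of n "t + r"]] by (simp add: kd_def)
      show "isCont (\<lambda>t. kd (t + r) n) t" for t
        unfolding kd_def
        by (intro continuous_intros isCont_o2[OF _ DERIV_isCont[OF kernel_has_derivative]])
    qed
    consider "r \<ge> - t1" | "- t2 \<le> r" "r < - t1" | "r < - t2" by linarith
    then show ?thesis
    proof cases
      case 1
      then have "g t r = kd (t + r) n * indicator {t1..t2} t" for t
        by (auto simp: g_def Q_def indicator_def n_def)
      then show ?thesis using FTC[OF t12] 1 t12 by (auto simp: P_def n_def)
    next
      case 2
      then have "g t r = kd (t + r) n * indicator {-r..t2} t" for t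
        by (auto simp: g_def Q_def indicator_def n_def)
      then show ?thesis using FTC[of "- r"] 2 t12 H by (auto simp: P_def n_def)
    next
      case 3
      then have "g t r = 0" for t
        by (auto simp: g_def Q_def indicator_def)
      then show ?thesis using 3 t12 by (auto simp: P_def)
    qed
  qed

  have Icc_int: "integrable lborel (indicator {a..b} :: real \<Rightarrow> real)" for a b
    by (intro integrable_real_indicator) (auto simp: emeasure_lborel_Icc_eq)
  have H_int: "integrable lborel (\<lambda>t. indicator {t1..t2} t * H (x - c * t))"
  proof (rule Bochner_Integration.integrable_bound[OF Icc_int[of t1 t2]])
    show "AE t in lborel. norm (indicator {t1..t2} t * H (x - c * t)) \<le> norm (indicator {t1..t2} t :: real)"
      by (intro AE_I2) (auto simp: H_def indicator_def)
  qed measurable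
  have H_int': "integrable lborel (\<lambda>r. indicator {-t2..<-t1} r * H (x + c * r))"
  proof (rule Bochner_Integration.integrable_bound[OF Icc_int[of "-t2" "-t1"]])
    show "AE r in lborel. norm (indicator {-t2..<-t1} r * H (x + c * r)) \<le> norm (indicator {-t2..-t1} r :: real)"
      by (intro AE_I2) (auto simp: H_def indicator_def)
  qed measurable
  \<comment> \<open>The reflection \<open>r = - t\<close> yields the interval without its left
    endpoint, a null set.\<close>
  have "(LINT r|lborel. indicator {-t2..<-t1} r * H (x + c * r))
      = (LINT t|lborel. indicator {t1<..t2} t * H (x - c * t))"
    by (subst lborel_integral_real_affine[where c = "-1" and t = 0])
      (auto intro!: Bochner_Integration.integral_cong simp: indicator_def)
  also have "\<dots> = (LINT t|lborel. indicator {t1..t2} t * H (x - c * t))"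
    using AE_lborel_singleton[of t1]
    by (intro integral_cong_AE) (auto simp: indicator_def elim!: eventually_mono)
  finally have H_eq: "(LINT r|lborel. indicator {-t2..<-t1} r * H (x + c * r)) = \<dots>" .

  have outer: "(LINT r|lborel. g t r) = indicator {t1..t2} t * L t" for t
    using Q_integral by (simp add: g_def)
  have L_int: "integrable lborel (\<lambda>t. indicator {t1..t2} t * L t)"
    using lborel_pair.integrable_fst'[OF g_int] by (simp add: outer)
  have "(LINT t|lborel. indicator {t1..t2} t * L t) = (LINT r|lborel. LINT t|lborel. g t r)"
    using lborel_pair.Fubini_integral[OF g_int] by (simp add: outer)
  also have "\<dots> = front c (x - c * t2) - front c (x - c * t1)
      - (LINT t|lborel. indicator {t1..t2} t * H (x - c * t))"
    unfolding inner using P_int H_int' by (simp add: H_eq P_integral)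
  finally have "(LINT t|lborel. indicator {t1..t2} t * (L t + H (x - c * t)))
      = front c (x - c * t2) - front c (x - c * t1)"
    using L_int H_int by (simp add: distrib_left)
  moreover have "integrable lborel (\<lambda>t. indicator {t1..t2} t * (L t + H (x - c * t)))"
    using L_int H_int by (simp add: distrib_left)
  ultimately have "((\<lambda>t. indicator {t1..t2} t * (L t + H (x - c * t)))
      has_integral (front c (x - c * t2) - front c (x - c * t1))) UNIV"
    using has_integral_integral_lborel by metis
  moreover have "indicator {t1..t2} t * (L t + H (x - c * t))
      = (if t \<in> {t1..t2} then L t + H (x - c * t) else 0)" for t
    by simp
  ultimately show ?thesis
    by (simp only: has_integral_restrict_UNIV) (simp add: L_def H_def)
qed

lemma front_tendsto_at_top: "(front c \<longlongrightarrow> 1) at_top"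
proof (rule tendsto_at_topI_sequentially)
  fix X :: "nat \<Rightarrow> real"
  assume "filterlim X at_top sequentially"
  then have "filterlim (\<lambda>m. X m + c * s) at_top sequentially" for s
    using filterlim_tendsto_add_at_top[OF tendsto_const[of "c * s"], of X] by (simp add: add.commute)
  then show "(\<lambda>m. front c (X m)) \<longlonglongrightarrow> 1"
    by (intro front_at_top[where c = "\<lambda>_. c"])
qed

lemma front_tendsto_at_bot: "(front c \<longlongrightarrow> 0) at_bot"
  unfolding filterlim_at_bot_mirror
proof (rule tendsto_at_topI_sequentially)
  fix X :: "nat \<Rightarrow> real"
  assume X: "filterlim X at_top sequentially"
  have "filterlim (\<lambda>m. - X m + c * s) at_bot sequentially" for s
    using filterlim_tendsto_add_at_top[OF tendsto_const X, of "- c * s"]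
    by (simp add: filterlim_uminus_at_top algebra_simps)
  then show "(\<lambda>m. front c (- X m)) \<longlonglongrightarrow> 0"
    by (intro front_at_bot[where c = "\<lambda>_. c"])
qed

section \<open>The pinned front\<close>

text \<open>Solving for \<open>D n\<close> expresses it as \<open>q\<close> times a weighted mean of
  its neighbours with \<open>q < 1\<close>, so iterating the bound drives it to 0. By linearity this
  is uniqueness of bounded solutions of the pinned equation.\<close>

lemma bounded_resolvent_solution_trivial:
  fixes D :: "int \<Rightarrow> real"
  assumes eq: "\<And>n. d * (k * D (n + 1) - (k + 1) * D n + D (n - 1)) = D n"
    and bound: "\<And>n. \<bar>D n\<bar> \<le> M"
  shows "D n = 0"
proof -
  define q where "q = total_rate / (total_rate + 1)"
  have q: "0 \<le> q" "q < 1" using total_rate_pos by (auto simp: q_def field_simps)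
  have "\<bar>D n\<bar> \<le> q ^ j * M" for j n
  proof (induction j arbitrary: n)
    case (Suc j)
    have "(total_rate + 1) * D n = d * (k * D (n + 1) + D (n - 1))"
      using eq[of n] by (simp add: total_rate_def algebra_simps)
    then have "(total_rate + 1) * \<bar>D n\<bar> = d * \<bar>k * D (n + 1) + D (n - 1)\<bar>"
      using total_rate_pos d_pos by (metis abs_mult abs_of_pos add_pos_pos zero_less_one)
    also have "\<dots> \<le> d * (k * (q ^ j * M) + q ^ j * M)"
      using Suc[of "n + 1"] Suc[of "n - 1"] d_pos k_pos
      by (intro mult_left_mono order_trans[OF abs_triangle_ineq] add_mono) (auto simp: abs_mult)
    also have "\<dots> = total_rate * (q ^ j * M)" by (simp add: total_rate_def algebra_simps)
    finally have "\<bar>D n\<bar> \<le> total_rate * (q ^ j * M) / (total_rate + 1)"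
      using total_rate_pos by (simp add: pos_le_divide_eq mult.commute)
    then show ?case by (simp add: q_def)
  qed (use bound in auto)
  moreover have "(\<lambda>j. q ^ j * M) \<longlonglongrightarrow> 0 * M"
    using q by (intro tendsto_mult LIMSEQ_realpow_zero tendsto_const)
  ultimately have "\<bar>D n\<bar> \<le> 0"
    by (intro Lim_bounded2[of "\<lambda>j. q ^ j * M" _ 0]) auto
  then show ?thesis by simp
qed

text \<open>The case \<open>c = 0\<close> of the front equation, where the integrand does not depend on time.\<close>

lemma pinned_front_equation:
  "d * (k * front 0 (of_int n + 1) - (k + 1) * front 0 (of_int n) + front 0 (of_int n - 1))
     - front 0 (of_int n) + (if n \<ge> 0 then 1 else 0) = 0" (is "?e = 0")
proof -
  have "((\<lambda>t::real. ?e) has_integral 0) {0..1}"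
    using front_linear_equation[of 0 1 0 "of_int n"] by simp
  moreover have "((\<lambda>t::real. ?e) has_integral ?e) {0..1}"
    using has_integral_const_real[of ?e 0 1] by simp
  ultimately show ?thesis using has_integral_unique by blast
qed

context
  fixes x :: real
  assumes x: "0 < x" "x < 1" "k * x < 1" and dx: "d * ((1 - x) * (1 - k * x)) = x"
begin

private definition A where "A = pinning_upper k x"

text \<open>The characteristic equation has the roots \<open>x\<close> and
  \<open>1 / (k * x)\<close>, with product \<open>1 / k\<close>. The first gives the decay towards 1
  on the right, the second the decay towards 0 on the left.\<close>

private definition W :: "int \<Rightarrow> real" where
  "W n = (if n \<ge> 0 then 1 - (1 - A) * x ^ nat n else A * (k * x) ^ nat (- n))"

private lemma denominator_pos: "1 - k * x\<^sup>2 > 0"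
proof -
  have "k * x * x < 1 * 1" using x k_pos by (intro mult_strict_mono) auto
  then show ?thesis by (simp add: power2_eq_square algebra_simps)
qed

private lemma A_bounds: "0 < A" "A < 1"
proof -
  show "0 < A" using denominator_pos x by (simp add: A_def pinning_upper_def)
  have "k * x * x < 1 * x" using x by (intro mult_strict_right_mono) auto
  then show "A < 1" using denominator_pos by (simp add: A_def pinning_upper_def power2_eq_square)
qed

text \<open>This condition determines \<open>A\<close>: the two branches of \<open>W\<close>, which
  meet at 0, must also agree at -1. The right branch can then be used at -1 in the equation at site
  0.\<close>

private lemma matching: "A * (k * x) = 1 - (1 - A) / x"
  using denominator_pos x by (simp add: A_def pinning_upper_def field_simps power2_eq_square)

private lemma W_neg: "W (- int m) = A * (k * x) ^ m"
  by (cases "m = 0") (auto simp: W_def)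

private lemma W_nonneg: "W (int m - 1) = 1 - (1 - A) * (x ^ m / x)"
proof (cases m)
  case 0
  then show ?thesis using matching by (simp add: W_def)
qed (use x in \<open>simp add: W_def\<close>)

private lemma W_equation:
  "d * (k * W (n + 1) - (k + 1) * W n + W (n - 1)) - W n + (if n \<ge> 0 then 1 else 0) = 0"
proof (cases "n \<ge> 0")
  case True
  then obtain m where n: "n = int m" by (metis nonneg_int_cases)
  have W: "W (n + 1) = 1 - (1 - A) * x ^ m * x" "W n = 1 - (1 - A) * x ^ m"
    "W (n - 1) = 1 - (1 - A) * x ^ m / x"
    using W_nonneg[of m] W_nonneg[of "Suc m"] W_nonneg[of "Suc (Suc m)"] x
    by (auto simp: n add_ac)
  have "d * (k * W (n + 1) - (k + 1) * W n + W (n - 1)) - W n + 1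
      = - ((1 - A) * x ^ m / x) * (d * ((1 - x) * (1 - k * x)) - x)"
    unfolding W using x by (simp add: field_simps)
  then show ?thesis using True dx by simp
next
  case False
  then obtain m where n: "n = - int (Suc m)"
    by (metis int_cases not_less_iff_gr_or_eq of_nat_0_le_iff)
  have W: "W (n + 1) = A * (k * x) ^ m" "W n = A * (k * x) ^ m * (k * x)"
    "W (n - 1) = A * (k * x) ^ m * (k * x) * (k * x)"
    using W_neg[of m] W_neg[of "Suc m"] W_neg[of "Suc (Suc m)"]
    by (auto simp: n mult_ac)
  have "d * (k * W (n + 1) - (k + 1) * W n + W (n - 1)) - W n
      = A * (k * x) ^ m * k * (d * ((1 - x) * (1 - k * x)) - x)"
    unfolding W by (simp add: algebra_simps)
  then show ?thesis using False dx by simp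
qed

private lemma W_bounded: "\<bar>W n\<bar> \<le> 1"
proof -
  have "0 \<le> r * y ^ j \<and> r * y ^ j \<le> 1" if "0 \<le> r" "r \<le> 1" "0 \<le> y" "y \<le> 1" for r y :: real and j
    using that by (simp add: mult_le_one power_le_one)
  from this[of "1 - A" x "nat n"] this[of A "k * x" "nat (- n)"] show ?thesis
    using A_bounds x k_pos by (auto simp: W_def)
qed

text \<open>Both sides are bounded and solve the same inhomogeneous linear equation, so their
  difference vanishes.\<close>

private lemma pinned_front_explicit: "front 0 (of_int n) = W n"
proof -
  have "front 0 (of_int n) - W n = 0"
  proof (rule bounded_resolvent_solution_trivial[where M = 2])
    fix n :: int
    show "d * (k * (front 0 (of_int (n + 1)) - W (n + 1)) - (k + 1) * (front 0 (of_int n) - W n)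
        + (front 0 (of_int (n - 1)) - W (n - 1))) = front 0 (of_int n) - W n"
      using pinned_front_equation[of n] W_equation[of n] by (simp add: algebra_simps)
    show "\<bar>front 0 (of_int n) - W n\<bar> \<le> 2"
      using W_bounded[of n] front_nonneg[of 0 "of_int n"] front_le_1[of 0 "of_int n"] by simp
  qed
  then show ?thesis by simp
qed

lemma pinned_front_0: "front 0 0 = pinning_upper k x"
  using pinned_front_explicit[of 0] by (simp add: W_def A_def)

lemma pinned_front_minus_1: "front 0 (- 1) = pinning_lower k x"
  using pinned_front_explicit[of "- 1"] by (simp add: W_def A_def pinning_lower_def)

lemma pinned_front_strict_mono: "strict_mono (\<lambda>n::int. front 0 (of_int n))"
proof -
  have step: "W n < W (n + 1)" for n
  proof (cases "n \<ge> 0")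
    case True
    then have "nat (n + 1) = Suc (nat n)" by simp
    then show ?thesis using True A_bounds x by (simp add: W_def)
  next
    case False
    then obtain m where n: "n = - int (Suc m)"
      by (metis int_cases not_less_iff_gr_or_eq of_nat_0_le_iff)
    have "A * (k * x) ^ m * (k * x) < A * (k * x) ^ m * 1"
      using A_bounds x k_pos by (intro mult_strict_left_mono) auto
    then show ?thesis using W_neg[of m] W_neg[of "Suc m"] by (simp add: n mult_ac)
  qed
  show ?thesis
  proof (rule strict_monoI)
    fix m n :: int
    assume "m < n"
    then have "W m < W n"
      by (induction n rule: int_gr_induct) (auto intro: step less_trans)
    then show "front 0 (of_int m) < front 0 (of_int n)"
      by (simp add: pinned_front_explicit)
  qed
qed

end

text \<open>By monotonicity the two bounds put the sites \<open>n < 0\<close> below \<open>a\<close>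
  and the sites \<open>n \<ge> 0\<close> at or above it, so the nonlinearity reduces to the linear
  one with a step. The bounds are half-open because \<open>g_MK\<close> takes its upper branch at
  \<open>a\<close>.\<close>

lemma stationary_wave_front:
  assumes x: "0 < x" "x < 1" "k * x < 1" "d * ((1 - x) * (1 - k * x)) = x"
    and a: "pinning_lower k x < a" "a \<le> pinning_upper k x"
  shows "stationary_wave d k a (\<lambda>n. front 0 (of_int n))"
  unfolding stationary_wave_def lattice_solution_def
proof (intro conjI allI impI pinned_front_strict_mono[OF x])
  have g: "g_MK a (front 0 (of_int n)) = - front 0 (of_int n) + (if n \<ge> 0 then 1 else 0)" for n :: int
  proof (cases "n \<ge> 0")
    case True
    then show ?thesis
      using front_mono[of 0 "of_int n" 0] pinned_front_0[OF x] a by (auto simp: g_MK_def)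
  next
    case False
    then have "of_int n \<le> (- 1 :: real)" by simp
    then show ?thesis
      using False front_mono[of "of_int n" "- 1" 0] pinned_front_minus_1[OF x] a
      by (auto simp: g_MK_def)
  qed
  fix i :: int and s t :: real
  have "lattice_rhs d k a (\<lambda>i t. front 0 (of_int i)) i = (\<lambda>_. 0)"
    using pinned_front_equation[of i] by (auto simp: lattice_rhs_def g)
  then show "(lattice_rhs d k a (\<lambda>i t. front 0 (of_int i)) i has_integral
      front 0 (of_int i) - front 0 (of_int i)) {s..t}"
    by simp
next
  show "((\<lambda>n::int. front 0 (of_int n)) \<longlongrightarrow> 1) at_top"
    by (rule filterlim_compose[OF front_tendsto_at_top filterlim_real_of_int_at_top])
  have "filterlim (real_of_int) at_bot at_bot"
    unfolding filterlim_at_bot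
  proof
    fix Z :: real
    show "eventually (\<lambda>n. real_of_int n \<le> Z) at_bot"
      by (rule eventually_mono[OF eventually_le_at_bot[of "\<lfloor>Z\<rfloor>"]]) linarith
  qed
  then show "((\<lambda>n::int. front 0 (of_int n)) \<longlongrightarrow> 0) at_bot"
    by (rule filterlim_compose[OF front_tendsto_at_bot])
qed

section \<open>Moving fronts\<close>

text \<open>Strict monotonicity at the origin ensures that the profile reaches the level
  \<open>a\<close> exactly on \<open>y \<ge> 0\<close>, so that \<open>g_MK\<close> agrees with the
  linear reaction plus the step.\<close>

lemma traveling_wave_front:
  assumes "c \<noteq> 0" and a: "front c 0 = a"
  shows "traveling_wave d k a c (front c)"
  unfolding traveling_wave_def lattice_solution_def
proof (intro conjI allI impI assms(1) front_tendsto_at_top front_tendsto_at_bot)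
  have g: "g_MK a (front c y) = - front c y + (if y \<ge> 0 then 1 else 0)" for y
    using front_mono[of 0 y c] front_strict[OF assms(1), of y] a by (auto simp: g_MK_def)
  fix i :: int and s t :: real
  assume "0 < s \<and> s \<le> t"
  moreover have "lattice_rhs d k a (\<lambda>i t. front c (of_int i - c * t)) i =
      (\<lambda>t. d * (k * front c (of_int i + 1 - c * t) - (k + 1) * front c (of_int i - c * t)
          + front c (of_int i - 1 - c * t)) - front c (of_int i - c * t)
        + (if of_int i - c * t \<ge> 0 then 1 else 0))"
    by (simp add: fun_eq_iff lattice_rhs_def g)
  ultimately show "(lattice_rhs d k a (\<lambda>i t. front c (of_int i - c * t)) i has_integral
      front c (of_int i - c * t) - front c (of_int i - c * s)) {s..t}"
    by (simp only: front_linear_equation)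
qed

text \<open>For fixed \<open>c \<noteq> 0\<close> the floor of \<open>c * s\<close> is locally
  constant in the speed unless \<open>c * s\<close> is an integer, which happens only for countably
  many \<open>s\<close>.\<close>

lemma continuous_front_speed: "continuous_on (- {0}) (\<lambda>c. front c 0)"
  unfolding continuous_on_sequentially o_def
proof (intro allI ballI impI)
  fix X and c :: real
  assume c: "c \<in> - {0}" and X: "(\<forall>n. X n \<in> - {0}) \<and> X \<longlonglongrightarrow> c"
  have "(\<lambda>m. front (X m) 0) \<longlonglongrightarrow> (LINT s|lborel. indicator {0..} s * kernel s \<lfloor>0 + c * s\<rfloor>)"
  proof (rule front_limit[where N = "(\<lambda>z. z / c) ` \<int>"])
    fix s :: real
    assume "s \<notin> (\<lambda>z. z / c) ` \<int>"
    then have "c * s \<notin> \<int>" using c by (metis ComplD image_eqI insertI1 nonzero_mult_div_cancel_left)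
    moreover have "(\<lambda>m. X m * s) \<longlonglongrightarrow> c * s" using X by (intro tendsto_intros) auto
    ultimately have "eventually (\<lambda>m. \<lfloor>X m * s\<rfloor> = \<lfloor>c * s\<rfloor>) sequentially"
      by (intro eventually_floor_eq)
    then show "(\<lambda>m. kernel s \<lfloor>0 + X m * s\<rfloor>) \<longlonglongrightarrow> kernel s \<lfloor>0 + c * s\<rfloor>"
      by (intro tendsto_eventually) (auto elim!: eventually_mono)
  qed (auto intro: countable_int)
  then show "(\<lambda>n. front (X n) 0) \<longlonglongrightarrow> front c 0"
    by (simp only: front_def)
qed

lemma front_speed_intermediate:
  assumes "connected S" "0 \<notin> S" "c1 \<in> S" "c2 \<in> S" "front c1 0 < a" "a < front c2 0"
  shows "\<exists>c\<in>S. front c 0 = a"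
proof -
  have "connected ((\<lambda>c. front c 0) ` S)"
    using assms(1,2)
    by (intro connected_continuous_image continuous_on_subset[OF continuous_front_speed]) auto
  then have "a \<in> (\<lambda>c. front c 0) ` S"
    by (rule connectedD_interval[of _ "front c1 0" "front c2 0"]) (use assms in auto)
  then show ?thesis by auto
qed

text \<open>Approaching speed 0 from the right freezes the floor at 0, from the left at -1. The
  one-sided limits of \<open>front c 0\<close> are therefore \<open>front 0 0\<close> and
  \<open>front 0 (- 1)\<close>.\<close>

lemma small_speed_floor:
  assumes "s > 0"
  shows "eventually (\<lambda>m. \<lfloor>0 + inverse (real (Suc m)) * s\<rfloor> = 0 \<and>
    \<lfloor>0 + - inverse (real (Suc m)) * s\<rfloor> = - 1) sequentially"
proof -
  have "(\<lambda>m. inverse (real (Suc m)) * s) \<longlonglongrightarrow> 0 * s"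
    by (intro tendsto_mult LIMSEQ_inverse_real_of_nat tendsto_const)
  then have "eventually (\<lambda>m. inverse (real (Suc m)) * s < 1) sequentially"
    by (intro order_tendstoD(2)) auto
  then show ?thesis
  proof eventually_elim
    case (elim m)
    have "inverse (real (Suc m)) * s > 0" using assms by simp
    with elim show ?case by (simp only: floor_eq_iff) simp
  qed
qed

text \<open>On the positive speeds \<open>front c 0\<close> is continuous, is below \<open>a\<close>
  for small \<open>c\<close> by the right-hand limit \<open>front 0 0\<close>, and tends to 1 for
  large \<open>c\<close>.\<close>

lemma exists_positive_speed:
  assumes "front 0 0 < a" "a < 1"
  shows "\<exists>c>0. front c 0 = a"
proof -
  have "(\<lambda>m. front (inverse (real (Suc m))) 0) \<longlonglongrightarrow> (LINT s|lborel. indicator {0..} s * kernel s 0)"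
  proof (rule front_limit[where N = "{}"])
    show "(\<lambda>m. kernel s \<lfloor>0 + inverse (real (Suc m)) * s\<rfloor>) \<longlonglongrightarrow> kernel s 0" if "s > 0" for s
      by (rule tendsto_eventually, rule eventually_mono[OF small_speed_floor[OF that]]) (simp only:)
  qed auto
  then have "eventually (\<lambda>m. front (inverse (real (Suc m))) 0 < a) sequentially"
    by (rule order_tendstoD(2)) (use assms in \<open>simp add: front_def\<close>)
  then obtain m where m: "front (inverse (real (Suc m))) 0 < a"
    by (auto simp: eventually_sequentially)
  have "(\<lambda>m. front (real m) 0) \<longlonglongrightarrow> 1"
    by (rule front_at_top)
      (auto intro!: filterlim_at_top_mult_tendsto_pos[OF tendsto_const] filterlim_real_sequentially)
  then have "eventually (\<lambda>m. a < front (real m) 0) sequentially"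
    using assms by (intro order_tendstoD(1)) auto
  then have "eventually (\<lambda>m. a < front (real m) 0 \<and> m > 0) sequentially"
    using eventually_gt_at_top[of "0::nat"] by eventually_elim simp
  then obtain n where n: "a < front (real n) 0" "n > 0"
    by (auto simp: eventually_sequentially)
  have "\<exists>c\<in>{0<..}. front c 0 = a"
    by (rule front_speed_intermediate[OF _ _ _ _ m n(1)]) (use n(2) in simp_all)
  then show ?thesis by auto
qed

lemma exists_negative_speed:
  assumes "0 < a" "a < front 0 (- 1)"
  shows "\<exists>c<0. front c 0 = a"
proof -
  have "(\<lambda>m. front (- inverse (real (Suc m))) 0)
      \<longlonglongrightarrow> (LINT s|lborel. indicator {0..} s * kernel s (- 1))"
  proof (rule front_limit[where N = "{}"])
    show "(\<lambda>m. kernel s \<lfloor>0 + - inverse (real (Suc m)) * s\<rfloor>) \<longlonglongrightarrow> kernel s (- 1)" if "s > 0" for s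
      by (rule tendsto_eventually, rule eventually_mono[OF small_speed_floor[OF that]]) (simp only:)
  qed auto
  then have "eventually (\<lambda>m. a < front (- inverse (real (Suc m))) 0) sequentially"
    by (rule order_tendstoD(1)) (use assms floor_of_int[where 'a = real, of "- 1"] in \<open>simp add: front_def\<close>)
  then obtain m where m: "a < front (- inverse (real (Suc m))) 0"
    by (auto simp: eventually_sequentially)
  have "(\<lambda>m. front (- real m) 0) \<longlonglongrightarrow> 0"
  proof (rule front_at_bot)
    fix s :: real
    assume "s > 0"
    then have "filterlim (\<lambda>m. real m * s) at_top sequentially"
      by (intro filterlim_at_top_mult_tendsto_pos[OF tendsto_const] filterlim_real_sequentially)
    then show "filterlim (\<lambda>m. 0 + - real m * s) at_bot sequentially"
      by (simp add: filterlim_uminus_at_top)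
  qed
  then have "eventually (\<lambda>m. front (- real m) 0 < a) sequentially"
    using assms by (intro order_tendstoD(2)) auto
  then have "eventually (\<lambda>m. front (- real m) 0 < a \<and> m > 0) sequentially"
    using eventually_gt_at_top[of "0::nat"] by eventually_elim simp
  then obtain n where n: "front (- real n) 0 < a" "n > 0"
    by (auto simp: eventually_sequentially)
  have "\<exists>c\<in>{..<0}. front c 0 = a"
    by (rule front_speed_intermediate[OF _ _ _ _ n(1) m]) (use n(2) in simp_all)
  then show ?thesis by auto
qed

end

section \<open>Dependence of the pinning interval on the coupling\<close>

text \<open>The root equation solved for \<open>d\<close>, so that the root \<open>x\<close> can
  serve as parameter instead of the coupling.\<close>

definition root_coupling :: "real \<Rightarrow> real \<Rightarrow> real" where
  "root_coupling k x = x / ((1 - x) * (1 - k * x))"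

lemma root_coupling_less:
  assumes "k > 1" "0 < x" "x < y" "k * y < 1"
  shows "root_coupling k x < root_coupling k y"
proof -
  have kxy: "k * x < k * y" and "y < k * y"
    using assms by auto
  then have y: "x < 1" "y < 1" using assms by linarith+
  have "(1 - y) * (1 - k * y) \<le> (1 - x) * (1 - k * x)"
    using assms kxy y by (intro mult_mono) auto
  moreover have "0 < (1 - y) * (1 - k * y)"
    using assms y by (intro mult_pos_pos) auto
  ultimately show ?thesis
    unfolding root_coupling_def using assms by (intro frac_less) auto
qed

lemma root_coupling_less_iff:
  assumes "k > 1" "0 < x" "k * x < 1" "0 < y" "k * y < 1"
  shows "root_coupling k x < root_coupling k y \<longleftrightarrow> x < y"
  using root_coupling_less[of k x y] root_coupling_less[of k y x] assms
  by (cases x y rule: linorder_cases) auto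

text \<open>The root equation changes sign between 0 and \<open>1 / k\<close>.\<close>

lemma root_coupling_surj:
  assumes "k > 1" "d > 0"
  obtains x :: real where "0 < x" "k * x < 1" "x < 1" "d * ((1 - x) * (1 - k * x)) = x"
    "d = root_coupling k x"
proof -
  define f where "f x = d * ((1 - x) * (1 - k * x)) - x" for x :: real
  have f: "f 0 > 0" "f (1 / k) < 0" using assms by (auto simp: f_def)
  obtain x where x: "0 \<le> x" "x \<le> 1 / k" "f x = 0"
    using IVT2'[of f "1 / k" 0 0] f assms unfolding f_def[abs_def]
    by (force intro!: continuous_intros)
  then have "0 < x" "x < 1 / k" using f by (metis less_eq_real_def less_irrefl)+
  then have kx: "0 < x" "k * x < 1" using assms by (auto simp: field_simps)
  moreover have "x < k * x" using assms kx by simp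
  ultimately have "x < 1" by linarith
  moreover have "d * ((1 - x) * (1 - k * x)) = x" using x by (simp add: f_def)
  moreover from this have "d = root_coupling k x"
    using kx \<open>x < 1\<close> by (simp add: root_coupling_def eq_divide_eq)
  ultimately show thesis using kx that by blast
qed

text \<open>Since \<open>1 - k * x\<^sup>2\<close> is positive, both comparisons with
  \<open>a\<close> become sign conditions on quadratics: \<open>q\<close> for the upper end,
  \<open>r\<close> for the lower one.\<close>

lemma pinning_thresholds:
  fixes k a :: real
  assumes k: "k > 1" and a: "0 < a" "a < 1" and star: "a > a_plus_star k"
  obtains x1 x2 x3 :: real where "0 < x1" "x1 < x2" "x2 < x3" "k * x3 < 1"
    "\<And>x. 0 < x \<Longrightarrow> k * x < 1 \<Longrightarrow> a \<le> pinning_upper k x \<longleftrightarrow> x \<le> x1 \<or> x2 \<le> x"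
    "\<And>x. 0 < x \<Longrightarrow> k * x < 1 \<Longrightarrow> pinning_lower k x < a \<longleftrightarrow> x < x3"
    "\<And>x. 0 < x \<Longrightarrow> k * x < 1 \<Longrightarrow> a < pinning_lower k x \<longleftrightarrow> x3 < x"
proof -
  \<comment> \<open>\<open>p / k\<close> is the minimiser of \<open>pinning_upper k\<close> on the
    admissible interval, and \<open>1 / (2 * p)\<close> is the minimum.\<close>
  define p where "p = k - sqrt (k * (k - 1))"
  define q where "q x = a * k * x\<^sup>2 - x + 1 - a" for x
  define r where "r x = k * x * (1 - x) - a * (1 - k * x\<^sup>2)" for x
  have "k * (k - 1) < k\<^sup>2" "(k - 1)\<^sup>2 < k * (k - 1)"
    using k by (auto simp: power2_eq_square algebra_simps)
  then have "sqrt (k * (k - 1)) < k" "k - 1 < sqrt (k * (k - 1))"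
    using k by (auto intro: real_less_lsqrt real_less_rsqrt)
  then have p: "0 < p" "p < 1" by (auto simp: p_def)
  have "(k - p)\<^sup>2 = k * (k - 1)" using k by (simp add: p_def)
  then have p_eq: "p\<^sup>2 = 2 * k * p - k" by (simp add: power2_eq_square algebra_simps)
  have "a_plus_star k = 1 / (2 * p)" by (simp add: a_plus_star_def p_def)
  then have ap: "1 < 2 * a * p"
    using star p by (simp add: divide_less_eq mult_ac)
  have a_half: "a > 1 / 2"
  proof -
    have "2 * a * p < 2 * a * 1" using p a by (intro mult_strict_left_mono) auto
    then show ?thesis using ap by simp
  qed
  have q_star: "q (p / k) < 0"
  proof -
    have "k * q (p / k) = a * p\<^sup>2 - p + k - a * k"
      using k by (simp add: q_def power2_eq_square field_simps)
    also have "\<dots> = 2 * a * k * (p - 1) - p + k" by (simp add: p_eq algebra_simps)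
    finally have 1: "k * q (p / k) = 2 * a * k * (p - 1) - p + k" .
    \<comment> \<open>The extra factor \<open>p\<close> produces \<open>2 * a * p\<close>, which
      exceeds 1 by \<open>ap\<close>; the inequality flips because \<open>k * (p - 1)\<close> is
      negative.\<close>
    have "p * (k * q (p / k)) = (2 * a * p) * (k * (p - 1)) - p\<^sup>2 + k * p"
      unfolding 1 by (simp add: power2_eq_square algebra_simps)
    also have "\<dots> < 1 * (k * (p - 1)) - p\<^sup>2 + k * p"
      using ap p k by (simp add: mult_less_cancel_right mult_less_0_iff)
    also have "\<dots> = 0" by (simp add: p_eq algebra_simps)
    finally show ?thesis using p k by (simp add: mult_less_0_iff)
  qed
  have q_0: "q 0 > 0" using a by (simp add: q_def)
  have q_1: "q (1 / k) > 0"
  proof -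
    have "q (1 / k) = (1 - a) * (1 - 1 / k)"
      using k by (simp add: q_def power2_eq_square field_simps)
    then show ?thesis using a k by simp
  qed
  have cont: "continuous_on A q" "continuous_on A r" for A
    unfolding q_def[abs_def] r_def[abs_def] by (auto intro!: continuous_intros)
  have star_bounds: "0 < p / k" "p / k < 1 / k"
    using p k by (auto intro: divide_strict_right_mono)
  obtain x1 where x1: "0 \<le> x1" "x1 \<le> p / k" "q x1 = 0"
    using IVT2'[of q "p / k" 0 0] cont q_star q_0 star_bounds by auto
  obtain x2 where x2: "p / k \<le> x2" "x2 \<le> 1 / k" "q x2 = 0"
    using IVT'[of q "p / k" 0 "1 / k"] cont q_star q_1 star_bounds by auto
  have "x1 \<noteq> 0" "x1 \<noteq> p / k" "x2 \<noteq> 1 / k"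
    using x1(3) x2(3) q_star q_0 q_1 by auto
  then have x12: "0 < x1" "x1 < x2" "x2 < 1 / k" using x1 x2 by linarith+
  have "(x2 - x1) * (a * k * (x1 + x2) - 1) = 0"
    using x1(3) x2(3) by (simp add: q_def power2_eq_square algebra_simps)
  then have vieta: "a * k * (x1 + x2) = 1" using x12 by simp
  have q_factor: "q x = a * k * (x - x1) * (x - x2)" for x
  proof -
    have "q x = q x - q x1" using x1 by simp
    also have "\<dots> = (x - x1) * (a * k * (x + x1) - a * k * (x1 + x2))"
      unfolding vieta by (simp add: q_def power2_eq_square algebra_simps)
    finally show ?thesis by (simp add: algebra_simps)
  qed

  have "r 0 < 0" "r (1 / k) > 0"
  proof -
    have "r (1 / k) = (1 - a) * (1 - 1 / k)"
      using k by (simp add: r_def power2_eq_square field_simps)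
    then show "r (1 / k) > 0" using a k by simp
  qed (use a in \<open>simp add: r_def\<close>)
  then obtain x3 where x3: "0 \<le> x3" "x3 \<le> 1 / k" "r x3 = 0"
    using IVT'[of r 0 0 "1 / k"] cont k by (auto simp: less_eq_real_def)
  have "x3 \<noteq> 1 / k" using x3(3) \<open>r (1 / k) > 0\<close> by auto
  then have "x3 < 1 / k" using x3(2) by linarith
  have k_less_1: "1 / k < 1" using k by simp
  \<comment> \<open>Subtracting \<open>r x3 = 0\<close> leaves \<open>x - x3\<close> times a factor
    that is positive because \<open>a > 1 / 2\<close> and \<open>x + x3 < 2\<close>.\<close>
  have r_sgn: "(r x < 0 \<longleftrightarrow> x < x3) \<and> (r x > 0 \<longleftrightarrow> x3 < x)" if "0 < x" "x < 1 / k" for x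
  proof -
    have "x + x3 < 2" using that \<open>x3 < 1 / k\<close> k_less_1 by linarith
    then have "(1 - a) * (x + x3) < (1 / 2) * 2"
      using a_half a that x3 by (intro mult_strict_mono) auto
    define z where "z = k * (1 - (1 - a) * (x + x3))"
    have pos: "z > 0" using k \<open>(1 - a) * (x + x3) < (1 / 2) * 2\<close> by (simp add: z_def)
    have "r x = r x - r x3" using x3 by simp
    also have "\<dots> = (x - x3) * z"
      by (simp add: z_def r_def power2_eq_square algebra_simps)
    finally show ?thesis using pos by (simp add: mult_less_0_iff zero_less_mult_iff)
  qed
  \<comment> \<open>At \<open>x2\<close> the upper end equals \<open>a\<close>, and the lower end is
    smaller by the factor \<open>k * x2 < 1\<close>.\<close>
  have "r x2 < 0"
  proof -
    have "r x2 = (1 - x2) * (k * x2 - 1)"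
      using x2(3) by (simp add: q_def r_def power2_eq_square algebra_simps)
    moreover have "x2 < 1" using x12 k_less_1 by linarith
    moreover have "k * x2 < 1" using x12 k by (simp add: field_simps)
    ultimately show ?thesis by (simp add: mult_less_0_iff)
  qed
  then have "x2 < x3" using r_sgn x12 by auto
  show thesis
  proof (rule that[of x1 x2 x3])
    fix x :: real
    assume x: "0 < x" "k * x < 1"
    have "x < k * x" using k x by simp
    then have "x < 1" using x by linarith
    then have "x * (k * x) < 1 * 1" using x k by (intro mult_strict_mono) auto
    then have den: "1 - k * x\<^sup>2 > 0" by (simp add: power2_eq_square algebra_simps)
    have "a \<le> pinning_upper k x \<longleftrightarrow> 0 \<le> q x"
      using den by (simp add: pinning_upper_def q_def pos_le_divide_eq algebra_simps)
    also have "\<dots> \<longleftrightarrow> x \<le> x1 \<or> x2 \<le> x"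
      using a k x12 by (auto simp: q_factor zero_le_mult_iff mult_le_0_iff)
    finally show "a \<le> pinning_upper k x \<longleftrightarrow> x \<le> x1 \<or> x2 \<le> x" .
    have "pinning_lower k x < a \<longleftrightarrow> r x < 0" "a < pinning_lower k x \<longleftrightarrow> 0 < r x"
      using den by (auto simp: pinning_upper_def pinning_lower_def r_def divide_less_eq less_divide_eq)
    then show "pinning_lower k x < a \<longleftrightarrow> x < x3" "a < pinning_lower k x \<longleftrightarrow> x3 < x"
      using r_sgn[of x] x k by (auto simp: field_simps)
  qed (use x12 \<open>x2 < x3\<close> \<open>x3 < 1 / k\<close> k in \<open>auto simp: field_simps\<close>)
qed

section \<open>Transfer of the thresholds from the root to the coupling\<close>

theorem corollary3p3:
  fixes k a :: real
  assumes "k > 1" and "0 < a" and "a < 1" and "a > a_plus_star k"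
  shows "\<exists>dlo_plus dup_plus dlo_minus :: real.
    0 < dlo_plus \<and> dlo_plus < dup_plus \<and> dup_plus < dlo_minus \<and>
    (\<forall>d. 0 < d \<and> d \<le> dlo_plus \<longrightarrow> (\<exists>v. stationary_wave d k a v)) \<and>
    (\<forall>d. dlo_plus < d \<and> d < dup_plus \<longrightarrow> (\<exists>c U. c > 0 \<and> traveling_wave d k a c U)) \<and>
    (\<forall>d. dup_plus \<le> d \<and> d < dlo_minus \<longrightarrow> (\<exists>v. stationary_wave d k a v)) \<and>
    (\<forall>d. d > dlo_minus \<longrightarrow> (\<exists>c U. c < 0 \<and> traveling_wave d k a c U))"
proof (rule pinning_thresholds[OF assms])
  fix x1 x2 x3
  assume order: "0 < x1" "x1 < x2" "x2 < x3" "k * x3 < 1"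
    and upper: "\<And>x. 0 < x \<Longrightarrow> k * x < 1 \<Longrightarrow> a \<le> pinning_upper k x \<longleftrightarrow> x \<le> x1 \<or> x2 \<le> x"
    and lower: "\<And>x. 0 < x \<Longrightarrow> k * x < 1 \<Longrightarrow> pinning_lower k x < a \<longleftrightarrow> x < x3"
      "\<And>x. 0 < x \<Longrightarrow> k * x < 1 \<Longrightarrow> a < pinning_lower k x \<longleftrightarrow> x3 < x"
  have "k * x1 < k * x2" "k * x2 < k * x3" using order assms(1) by auto
  then have kx: "k * x1 < 1" "k * x2 < 1" using order by auto
  \<comment> \<open>The three thresholds are the couplings whose roots are \<open>x1\<close>,
    \<open>x2\<close> and \<open>x3\<close>; monotonicity of \<open>?D\<close> translates each range
    of \<open>d\<close> into a range of the root.\<close>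
  let ?D = "root_coupling k"
  have D: "0 < ?D x1" "?D x1 < ?D x2" "?D x2 < ?D x3"
  proof -
    have "x1 < k * x1" using order assms(1) by simp
    then have "x1 < 1" using kx by linarith
    then show "0 < ?D x1" using order kx by (simp add: root_coupling_def)
  qed (use root_coupling_less assms(1) order kx in auto)
  note less_iff = root_coupling_less_iff[OF assms(1)]
  have le_iff: "?D x \<le> ?D y \<longleftrightarrow> x \<le> y" if "0 < x" "k * x < 1" "0 < y" "k * y < 1" for x y
    using less_iff[of y x] that by (simp add: not_less[symmetric])
  have stationary: "\<exists>v. stationary_wave d k a v" if "0 < d" "d \<le> ?D x1 \<or> ?D x2 \<le> d \<and> d < ?D x3" for d
  proof -
    interpret biased_walk d k by unfold_locales (use that assms in auto)
    obtain x where x: "0 < x" "k * x < 1" "x < 1" "d * ((1 - x) * (1 - k * x)) = x"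
      and d: "d = ?D x"
      using root_coupling_surj[OF assms(1) \<open>0 < d\<close>] .
    have "x \<le> x1 \<or> x2 \<le> x \<and> x < x3"
      using that(2) x order kx assms(1) by (auto simp: d less_iff le_iff)
    then have "pinning_lower k x < a" "a \<le> pinning_upper k x"
      using x order upper lower by auto
    then show ?thesis using stationary_wave_front x by blast
  qed
  have speed_pos: "\<exists>c U. c > 0 \<and> traveling_wave d k a c U" if "?D x1 < d" "d < ?D x2" for d
  proof -
    have "0 < d" using that D by linarith
    interpret biased_walk d k by unfold_locales (use \<open>0 < d\<close> assms in auto)
    obtain x where x: "0 < x" "k * x < 1" "x < 1" "d * ((1 - x) * (1 - k * x)) = x"
      and d: "d = ?D x"
      using root_coupling_surj[OF assms(1) \<open>0 < d\<close>] .
    have "x1 < x" "x < x2"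
      using that x order kx assms(1) by (auto simp: d less_iff)
    then have "front 0 0 < a"
      using upper[of x] x pinned_front_0[of x] by auto
    then obtain c where "c > 0" "front c 0 = a"
      using exists_positive_speed[of a] assms by blast
    then show ?thesis using traveling_wave_front[of c a] by auto
  qed
  have speed_neg: "\<exists>c U. c < 0 \<and> traveling_wave d k a c U" if "?D x3 < d" for d
  proof -
    have "0 < d" using that D by linarith
    interpret biased_walk d k by unfold_locales (use \<open>0 < d\<close> assms in auto)
    obtain x where x: "0 < x" "k * x < 1" "x < 1" "d * ((1 - x) * (1 - k * x)) = x"
      and d: "d = ?D x"
      using root_coupling_surj[OF assms(1) \<open>0 < d\<close>] .
    have "x3 < x"
      using that x order assms(1) by (auto simp: d less_iff)
    then have "a < front 0 (- 1)"
      using lower(2)[of x] x pinned_front_minus_1[of x] by auto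
    then obtain c where "c < 0" "front c 0 = a"
      using exists_negative_speed[of a] assms by blast
    then show ?thesis using traveling_wave_front[of c a] by auto
  qed
  show ?thesis
    using D stationary speed_pos speed_neg
    by (intro exI[of _ "?D x1"] exI[of _ "?D x2"] exI[of _ "?D x3"]) (auto intro: less_le_trans)
qed

end
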